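(* Let $\mathbf n=(n_k)_{k\ge 1}$ be a strictly increasing sequence of positive integers and let $\mathcal B$ be a basis in a Banach space $X$. The following are equivalent: (i) $\mathcal B$ is ($\mathbf n$, strong partially greedy). (ii) $\mathcal B$ is quasi-greedy and ($\mathbf n$, PSLC). (iii) $\mathcal B$ is quasi-greedy and ($\mathbf n$, superconservative). (iv) $\mathcal B$ is quasi-greedy and ($\mathbf n$, conservative).
   Context: $X$ is a separable infinite-dimensional Banach space over $\mathbb F=\mathbb R$ or $\mathbb C$, with dual $X^*$; $\mathbb N=\{1,2,\dots\}$. A basis of $X$ is a sequence $\mathcal B=(e_n)_{n\ge1}\subset X$ whose linear span is norm-dense and for which there is a sequence $(e_n^* )_{n\ge1}\subset X^*$ with $e_j^*(e_k)=\delta_{j,k}$ and $0<\inf_n\{\|e_n\|,\|e_n^*\|\}\le\sup_n\{\|e_n\|,\|e_n^*\|\}<\infty$ (then $e_n^*(x)\to0$ for every $x\in X$). For a finite set $A\subset\mathbb N$, $P_A(x)=\sum_{n\in A}e_n^*(x)e_n$. For $x\in X$, $m\in\mathbb N$, a greedy set of $x$ of order $m$ is a set $A\subset\mathbb N$ with $|A|=m$ and $\min_{n\in A}|e_n^*(x)|\ge\max_{n\notin A}|e_n^*(x)|$; $G_m(x)$ denotes $P_A(x)$ for such an $A$ (not necessarily unique). The sequence $\mathbf n$ is identified with the set $\{n_1,n_2,\dots\}$. Put $P^{\mathbf n}_0(x)=0$, $P^{\mathbf n}_k(x)=\sum_{i=1}^k e_{n_i}^*(x)e_{n_i}$, and $\widehat\sigma^{\mathbf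 n}_m(x)=\min_{0\le k\le m}\|x-P^{\mathbf n}_k(x)\|$. $\mathcal B$ is ($\mathbf n$, strong partially greedy) if there is $C\ge1$ with $\|x-G_m(x)\|\le C\,\widehat\sigma^{\mathbf n}_m(x)$ for all $x\in X$, $m\in\mathbb N$ and all choices of $G_m(x)$. $\mathcal B$ is quasi-greedy if there is $C>0$ with $\|G_m(x)\|\le C\|x\|$ for all $x\in X$, $m\in\mathbb N$ and all choices of $G_m(x)$. A sign is a sequence $\varepsilon=(\varepsilon_n)_n$ of scalars of modulus $1$; for finite $A$, $1_{\varepsilon A}=\sum_{n\in A}\varepsilon_ne_n$, $1_A=\sum_{n\in A}e_n$. $\|x\|_\infty=\max_n|e_n^*(x)|$, $\operatorname{supp}(x)=\{n:e_n^*(x)\ne0\}$. $A<B$ means $a<b$ for all $a\in A,b\in B$ (vacuously true if one set is empty). Let $\mathbb T(\mathbf n)$ be the collection of ordered pairs $(A,B)$ of finite subsets of $\mathbb N$ with $A\subset\mathbf n$, $|A|\le|B|$ and $A<B\cap\mathbf n$. $\mathcal B$ is ($\mathbf n$, superconservative) if there is $C>0$ with $\|1_{\varepsilon A}\|\le C\|1_{\delta B}\|$ for all $(A,B)\in\mathbb T(\mathbf n)$ and all signs $\varepsilon,\delta$; ($\mathbf n$, conservative) if $\|1_A\|\le C\|1_B\|$ for all $(A,B)\in\mathbb T(\mathbf n)$. $\mathcal B$ is ($\mathbf n$, PSLC) if there is $C\ge1$ with $\|x+1_{\varepsilon A}\|\le C\|x+1_{\delta B}\|$ for all $x\in X$ with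 $\|x\|_\infty\le1$, all $(A,B)\in\mathbb T(\mathbf n)$ with $B\cap\operatorname{supp}(x)=\emptyset$ and $A<(B\cup\operatorname{supp}(x))\cap\mathbf n$, and all signs $\varepsilon,\delta$. *)

theory Defs
  imports "HOL-Analysis.Analysis"
begin

text \<open>
  The scalar field is the real or the complex field. The class below says exactly this, up to an
  isometric isomorphism; its two intended instances follow.
\<close>

class real_or_complex = real_normed_field +
  assumes ex_isometric_embedding:
    "\<exists>\<phi> :: 'a \<Rightarrow> complex.
       (\<forall>x y. \<phi> (x + y) = \<phi> x + \<phi> y) \<and> (\<forall>x y. \<phi> (x * y) = \<phi> x * \<phi> y) \<and>
       (\<forall>r x. \<phi> (scaleR r x) = r *\<^sub>R \<phi> x) \<and> (\<forall>x. norm (\<phi> x) = norm x) \<and>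
       (range \<phi> = \<real> \<or> range \<phi> = UNIV)"

instance real :: real_or_complex
  by standard
    (rule exI[of _ complex_of_real], auto simp: Reals_def scaleR_conv_of_real)

instance complex :: real_or_complex
  by standard (rule exI[of _ id], auto)

text \<open>
  A Banach space over \<open>'k\<close>: the class \<open>banach\<close> supplies the complete norm and the underlying real
  structure; \<open>sc\<close> is the multiplication by scalars, compatible with both. For real scalars
  this forces \<open>sc = scaleR\<close>.
\<close>

locale banach_space_over = vector_space sc
  for sc :: "'k::real_or_complex \<Rightarrow> 'a::banach \<Rightarrow> 'a" +
  assumes scale_of_real: "sc (of_real r) x = r *\<^sub>R x"
    and norm_scale: "norm (sc c x) = norm c * norm x"

definition infinite_dimensional :: "('k::field \<Rightarrow> 'a::ab_group_add \<Rightarrow> 'a) \<Rightarrow> bool" where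
  "infinite_dimensional sc \<longleftrightarrow> (\<nexists>S. finite S \<and> module.span sc S = UNIV)"

text \<open>
  Throughout, sequences are indexed by \<open>nat\<close> starting from 0, so index \<open>j\<close> here is index
  \<open>j + 1\<close> in the usual notation; only the order of the indices matters. The coordinate functionals
  \<open>es\<close> are uniquely determined by \<open>e\<close>, by density of the span and continuity.
\<close>

locale banach_basis = banach_space_over sc
  for sc :: "'k::real_or_complex \<Rightarrow> 'a::banach \<Rightarrow> 'a" +
  fixes e :: "nat \<Rightarrow> 'a" and es :: "nat \<Rightarrow> 'a \<Rightarrow> 'k"
  assumes span_dense: "closure (span (range e)) = UNIV"
    and linear_es: "Vector_Spaces.linear sc (*) (es j)"
    and bounded_es: "bounded_linear (es j)"
    and biorthogonal: "es j (e k) = (if j = k then 1 else 0)"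
    and norms_Inf: "0 < Inf (range (\<lambda>j. norm (e j)) \<union> range (\<lambda>j. onorm (es j)))"
    and norms_bdd: "bdd_above (range (\<lambda>j. norm (e j)) \<union> range (\<lambda>j. onorm (es j)))"

definition coord_proj ::
  "('k \<Rightarrow> 'a::comm_monoid_add \<Rightarrow> 'a) \<Rightarrow> (nat \<Rightarrow> 'a) \<Rightarrow> (nat \<Rightarrow> 'a \<Rightarrow> 'k) \<Rightarrow> nat set \<Rightarrow> 'a \<Rightarrow> 'a" where
  "coord_proj sc e es A x = (\<Sum>j\<in>A. sc (es j x) (e j))"

definition greedy_set :: "(nat \<Rightarrow> 'a \<Rightarrow> 'k::real_normed_field) \<Rightarrow> 'a \<Rightarrow> nat \<Rightarrow> nat set \<Rightarrow> bool" where
  "greedy_set es x m A \<longleftrightarrow> finite A \<and> card A = m \<and> (\<forall>a\<in>A. \<forall>b. b \<notin> A \<longrightarrow> norm (es b x) \<le> norm (es a x))"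

definition seq_partial_sum ::
  "('k \<Rightarrow> 'a::comm_monoid_add \<Rightarrow> 'a) \<Rightarrow> (nat \<Rightarrow> 'a) \<Rightarrow> (nat \<Rightarrow> 'a \<Rightarrow> 'k) \<Rightarrow> (nat \<Rightarrow> nat) \<Rightarrow> nat \<Rightarrow> 'a \<Rightarrow> 'a" where
  "seq_partial_sum sc e es n k x = (\<Sum>i<k. sc (es (n i) x) (e (n i)))"

definition seq_error ::
  "('k \<Rightarrow> 'a::real_normed_vector \<Rightarrow> 'a) \<Rightarrow> (nat \<Rightarrow> 'a) \<Rightarrow> (nat \<Rightarrow> 'a \<Rightarrow> 'k) \<Rightarrow> (nat \<Rightarrow> nat) \<Rightarrow> nat \<Rightarrow> 'a \<Rightarrow> real" where
  "seq_error sc e es n m x = Min ((\<lambda>k. norm (x - seq_partial_sum sc e es n k x)) ` {0..m})"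

definition strong_partially_greedy ::
  "('k::real_normed_field \<Rightarrow> 'a::real_normed_vector \<Rightarrow> 'a) \<Rightarrow> (nat \<Rightarrow> 'a) \<Rightarrow> (nat \<Rightarrow> 'a \<Rightarrow> 'k) \<Rightarrow> (nat \<Rightarrow> nat) \<Rightarrow> bool" where
  "strong_partially_greedy sc e es n \<longleftrightarrow>
     (\<exists>C\<ge>1. \<forall>x. \<forall>m\<ge>1. \<forall>A. greedy_set es x m A \<longrightarrow>
        norm (x - coord_proj sc e es A x) \<le> C * seq_error sc e es n m x)"

definition quasi_greedy ::
  "('k::real_normed_field \<Rightarrow> 'a::real_normed_vector \<Rightarrow> 'a) \<Rightarrow> (nat \<Rightarrow> 'a) \<Rightarrow> (nat \<Rightarrow> 'a \<Rightarrow> 'k) \<Rightarrow> bool" where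
  "quasi_greedy sc e es \<longleftrightarrow>
     (\<exists>C>0. \<forall>x. \<forall>m\<ge>1. \<forall>A. greedy_set es x m A \<longrightarrow> norm (coord_proj sc e es A x) \<le> C * norm x)"

definition is_sign :: "(nat \<Rightarrow> 'k::real_normed_field) \<Rightarrow> bool" where
  "is_sign \<epsilon> \<longleftrightarrow> (\<forall>j. norm (\<epsilon> j) = 1)"

definition signed_sum :: "('k \<Rightarrow> 'a::comm_monoid_add \<Rightarrow> 'a) \<Rightarrow> (nat \<Rightarrow> 'a) \<Rightarrow> (nat \<Rightarrow> 'k) \<Rightarrow> nat set \<Rightarrow> 'a" where
  "signed_sum sc e \<epsilon> A = (\<Sum>j\<in>A. sc (\<epsilon> j) (e j))"

definition plain_sum :: "(nat \<Rightarrow> 'a::comm_monoid_add) \<Rightarrow> nat set \<Rightarrow> 'a" where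
  "plain_sum e A = (\<Sum>j\<in>A. e j)"

text \<open>
  For a basis the supremum is attained, since the coefficients of \<open>x\<close> tend to 0.
\<close>

definition coeff_sup_norm :: "(nat \<Rightarrow> 'a \<Rightarrow> 'k::real_normed_field) \<Rightarrow> 'a \<Rightarrow> real" where
  "coeff_sup_norm es x = (SUP j. norm (es j x))"

definition coeff_supp :: "(nat \<Rightarrow> 'a \<Rightarrow> 'k::zero) \<Rightarrow> 'a \<Rightarrow> nat set" where
  "coeff_supp es x = {j. es j x \<noteq> 0}"

definition set_before :: "nat set \<Rightarrow> nat set \<Rightarrow> bool" where
  "set_before A B \<longleftrightarrow> (\<forall>a\<in>A. \<forall>b\<in>B. a < b)"

definition admissible_pairs :: "(nat \<Rightarrow> nat) \<Rightarrow> (nat set \<times> nat set) set" where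
  "admissible_pairs n =
     {(A, B). finite A \<and> finite B \<and> A \<subseteq> range n \<and> card A \<le> card B \<and> set_before A (B \<inter> range n)}"

definition superconservative ::
  "('k::real_normed_field \<Rightarrow> 'a::real_normed_vector \<Rightarrow> 'a) \<Rightarrow> (nat \<Rightarrow> 'a) \<Rightarrow> (nat \<Rightarrow> nat) \<Rightarrow> bool" where
  "superconservative sc e n \<longleftrightarrow>
     (\<exists>C>0. \<forall>(A, B) \<in> admissible_pairs n. \<forall>\<epsilon> \<delta>. is_sign \<epsilon> \<longrightarrow> is_sign \<delta> \<longrightarrow>
        norm (signed_sum sc e \<epsilon> A) \<le> C * norm (signed_sum sc e \<delta> B))"

definition conservative :: "(nat \<Rightarrow> 'a::real_normed_vector) \<Rightarrow> (nat \<Rightarrow> nat) \<Rightarrow> bool" where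
  "conservative e n \<longleftrightarrow>
     (\<exists>C>0. \<forall>(A, B) \<in> admissible_pairs n. norm (plain_sum e A) \<le> C * norm (plain_sum e B))"

text \<open>Partial symmetry for largest coefficients.\<close>

definition pslc ::
  "('k::real_normed_field \<Rightarrow> 'a::real_normed_vector \<Rightarrow> 'a) \<Rightarrow> (nat \<Rightarrow> 'a) \<Rightarrow> (nat \<Rightarrow> 'a \<Rightarrow> 'k) \<Rightarrow> (nat \<Rightarrow> nat) \<Rightarrow> bool" where
  "pslc sc e es n \<longleftrightarrow>
     (\<exists>C\<ge>1. \<forall>x. coeff_sup_norm es x \<le> 1 \<longrightarrow>
        (\<forall>(A, B) \<in> admissible_pairs n.
           B \<inter> coeff_supp es x = {} \<longrightarrow> set_before A ((B \<union> coeff_supp es x) \<inter> range n) \<longrightarrow>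
           (\<forall>\<epsilon> \<delta>. is_sign \<epsilon> \<longrightarrow> is_sign \<delta> \<longrightarrow>
              norm (x + signed_sum sc e \<epsilon> A) \<le> C * norm (x + signed_sum sc e \<delta> B))))"

end

theory Submission
  imports Defs
begin

text \<open>
  Superconservativity is the hub: for quasi-greedy bases each of the other three properties is
  shown to be equivalent to it.

  A strong partially greedy basis is quasi-greedy because the empty partial sum is one of the
  competitors, and it is superconservative because of one test vector: given an admissible pair
  \<open>(A, B)\<close>, let \<open>D\<close> consist of the terms of the sequence up to \<open>Max A\<close> that lie outside \<open>A\<close>. In
  \<open>1\<^bsub>\<epsilon>A\<^esub> + 1\<^bsub>\<delta>B\<^esub> + 1\<^bsub>D\<^esub>\<close> the greedy algorithm may remove \<open>B \<union> D\<close> and leave \<open>1\<^bsub>\<epsilon>A\<^esub>\<close>, whereas the partial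
  sum along \<open>A \<union> D\<close> leaves \<open>1\<^bsub>\<delta>B\<^esub>\<close>.

  In the other direction quasi-greediness enters through two classical estimates, both obtained by
  writing a weighted sum as an average of unweighted sums over superlevel sets of the weights
  (\<open>norm_weighted_sum_le\<close>). The upper estimate \<open>norm_multiplier_sum_le\<close> bounds
  \<open>\<Sum>j\<in>A. c\<^sub>j \<delta>\<^sub>j e\<^sub>j\<close> with \<open>\<bar>c\<^sub>j\<bar> \<le> 1\<close> by \<open>1\<^bsub>\<delta>A\<^esub>\<close>; it makes signs irrelevant, so conservative and
  superconservative agree. The lower estimate \<open>norm_flattened_greedy_sum_le\<close> says that flattening
  the coefficients on a greedy set down to a common modulus costs only a constant factor.

  To compare a greedy set \<open>A\<close> with the initial segment \<open>D\<close> of the sequence, put \<open>z = x - P\<^sub>D x\<close>. Then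
  \<open>x - P\<^sub>A x = z - P\<^bsub>A - D\<^esub> z + P\<^bsub>D - A\<^esub> x\<close>. The set \<open>A - D\<close> is greedy for \<open>z\<close>, so the middle term is
  harmless; the last term has coefficients no larger than those of \<open>z\<close> on \<open>A - D\<close>, and
  \<open>(D - A, A - D)\<close> is an admissible pair, so it is controlled by the upper estimate on \<open>D - A\<close>,
  superconservativity, and the lower estimate on \<open>A - D\<close>.
\<close>

section \<open>Weighted sums and superlevel sets\<close>

text \<open>
  A discrete layer-cake argument. The smallest weight is split off from every term; the remaining
  weights are supported on a strict superlevel set, to which the induction hypothesis applies with
  that smallest weight as the new lower bound \<open>c\<close>.
\<close>

lemma norm_shifted_weighted_sum_le:
  fixes v :: "'i \<Rightarrow> 'b::real_normed_vector" and w :: "'i \<Rightarrow> real"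
  assumes "finite B"
    and "\<And>s. norm (\<Sum>j\<in>{j\<in>B. s < w j}. v j) \<le> K"
    and "\<And>j. j \<in> B \<Longrightarrow> c \<le> w j \<and> w j \<le> M" and "c \<le> M"
  shows "norm (\<Sum>j\<in>B. (w j - c) *\<^sub>R v j) \<le> (M - c) * K"
  using assms
proof (induction B arbitrary: c rule: finite_psubset_induct)
  case (psubset B)
  have K: "0 \<le> K" using norm_ge_zero psubset.prems(1) by (rule order_trans)
  show ?case
  proof (cases "B = {}")
    case True
    then show ?thesis using K psubset.prems(3) by simp
  next
    case False
    define w0 where "w0 = Min (w ` B)"
    define B' where "B' = {j\<in>B. w0 < w j}"
    have w0_le: "w0 \<le> w j" if "j \<in> B" for j
      using that psubset.hyps by (simp add: w0_def)
    obtain j0 where j0: "j0 \<in> B" "w j0 = w0"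
      using Min_in[of "w ` B"] False psubset.hyps by (metis empty_is_image finite_imageI imageE w0_def)
    have bounds: "c \<le> w0" "w0 \<le> M" using psubset.prems(2)[OF j0(1)] j0(2) by auto
    have "B' \<subset> B" using j0 by (auto simp: B'_def)
    moreover have "norm (\<Sum>j\<in>{j\<in>B'. s < w j}. v j) \<le> K" for s
    proof -
      have "{j\<in>B'. s < w j} = {j\<in>B. max s w0 < w j}" by (auto simp: B'_def)
      then show ?thesis using psubset.prems(1)[of "max s w0"] by (simp only:)
    qed
    ultimately have IH: "norm (\<Sum>j\<in>B'. (w j - w0) *\<^sub>R v j) \<le> (M - w0) * K"
      using psubset.IH[of B' w0] psubset.prems(2) bounds(2) by (auto simp: B'_def)
    have "{j\<in>B. w0 - 1 < w j} = B" using w0_le by force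
    then have sum_v: "norm (\<Sum>j\<in>B. v j) \<le> K" using psubset.prems(1)[of "w0 - 1"] by simp
    have "(\<Sum>j\<in>B'. (w j - w0) *\<^sub>R v j) = (\<Sum>j\<in>B. (w j - w0) *\<^sub>R v j)"
      using w0_le psubset.hyps
      by (intro sum.mono_neutral_left) (auto simp: B'_def order.order_iff_strict)
    then have split: "(\<Sum>j\<in>B. (w j - c) *\<^sub>R v j)
        = (w0 - c) *\<^sub>R (\<Sum>j\<in>B. v j) + (\<Sum>j\<in>B'. (w j - w0) *\<^sub>R v j)"
      by (simp add: scaleR_sum_right sum.distrib[symmetric] scaleR_add_left[symmetric])
    have "norm (\<Sum>j\<in>B. (w j - c) *\<^sub>R v j) \<le> (w0 - c) * K + (M - w0) * K"
      unfolding split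
      by (rule norm_triangle_le, rule add_mono)
        (use bounds(1) sum_v IH in \<open>auto intro: mult_left_mono\<close>)
    then show ?thesis by (simp add: algebra_simps)
  qed
qed

lemma norm_weighted_sum_le:
  fixes v :: "'i \<Rightarrow> 'b::real_normed_vector" and w :: "'i \<Rightarrow> real"
  assumes "finite B"
    and "\<And>s. norm (\<Sum>j\<in>{j\<in>B. s < w j}. v j) \<le> K"
    and "\<And>j. j \<in> B \<Longrightarrow> 0 \<le> w j \<and> w j \<le> 1"
  shows "norm (\<Sum>j\<in>B. w j *\<^sub>R v j) \<le> K"
  using norm_shifted_weighted_sum_le[OF assms(1,2), where c = 0 and M = 1] assms(3) by simp

lemma norm_signed_weighted_sum_le:
  fixes v :: "'i \<Rightarrow> 'b::real_normed_vector" and r :: "'i \<Rightarrow> real"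
  assumes "finite B"
    and "\<And>B'. B' \<subseteq> B \<Longrightarrow> norm (\<Sum>j\<in>B'. v j) \<le> K"
    and "\<And>j. j \<in> B \<Longrightarrow> \<bar>r j\<bar> \<le> 1"
  shows "norm (\<Sum>j\<in>B. r j *\<^sub>R v j) \<le> 2 * K"
proof -
  have "norm (\<Sum>j\<in>B. max (r j) 0 *\<^sub>R v j) \<le> K" "norm (\<Sum>j\<in>B. max (- r j) 0 *\<^sub>R v j) \<le> K"
    using assms(3) by (intro norm_weighted_sum_le assms(1,2); fastforce)+
  moreover have "(\<Sum>j\<in>B. r j *\<^sub>R v j)
      = (\<Sum>j\<in>B. max (r j) 0 *\<^sub>R v j) - (\<Sum>j\<in>B. max (- r j) 0 *\<^sub>R v j)"
    unfolding sum_subtractf[symmetric] scaleR_diff_left[symmetric]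
    by (intro sum.cong refl arg_cong2[where f = scaleR]) auto
  ultimately show ?thesis
    using norm_triangle_ineq4[of "\<Sum>j\<in>B. max (r j) 0 *\<^sub>R v j" "\<Sum>j\<in>B. max (- r j) 0 *\<^sub>R v j"]
    by simp
qed

text \<open>
  The only place where the scalar field matters: \<open>\<iota>\<close> is the imaginary unit over the complex
  numbers, and over the reals \<open>\<iota> = 1\<close> with \<open>b = 0\<close> will do.
\<close>

lemma ex_cartesian_decomposition:
  "\<exists>\<iota>::'k::real_or_complex. norm \<iota> = 1 \<and>
     (\<forall>c. \<exists>a b. c = of_real a + \<iota> * of_real b \<and> \<bar>a\<bar> \<le> norm c \<and> \<bar>b\<bar> \<le> norm c)"
proof -
  obtain \<phi> :: "'k \<Rightarrow> complex" where add: "\<And>x y. \<phi> (x + y) = \<phi> x + \<phi> y"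
    and mult: "\<And>x y. \<phi> (x * y) = \<phi> x * \<phi> y" and scale: "\<And>r x. \<phi> (scaleR r x) = r *\<^sub>R \<phi> x"
    and norm: "\<And>x. norm (\<phi> x) = norm x" and range: "range \<phi> = \<real> \<or> range \<phi> = UNIV"
    using ex_isometric_embedding[where 'a = 'k] by blast
  have one: "\<phi> 1 = 1"
  proof -
    have "\<phi> 1 * \<phi> 1 = \<phi> 1" using mult[of 1 1] by simp
    moreover have "\<phi> 1 \<noteq> 0" using norm[of 1] by auto
    ultimately show ?thesis by simp
  qed
  have of_real: "\<phi> (of_real r) = of_real r" for r
    by (simp add: of_real_def scale one)
  have inj: "x = y" if "\<phi> x = \<phi> y" for x y
  proof -
    have "\<phi> (x + (-1) *\<^sub>R y) = 0" unfolding add scale using that by simp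
    then show ?thesis using norm[of "x + (-1) *\<^sub>R y"] by simp
  qed
  from range show ?thesis
  proof
    assume real: "range \<phi> = \<real>"
    have "\<exists>a b. c = of_real a + 1 * of_real b \<and> \<bar>a\<bar> \<le> norm c \<and> \<bar>b\<bar> \<le> norm c" for c :: 'k
    proof -
      have "\<phi> c \<in> \<real>" using real by blast
      then obtain a where a: "\<phi> c = of_real a" by (auto elim: Reals_cases)
      then have "c = of_real a" by (intro inj) (simp add: of_real)
      then show ?thesis by (intro exI[of _ a] exI[of _ 0]) simp
    qed
    then show ?thesis by (intro exI[of _ 1]) simp
  next
    assume "range \<phi> = UNIV"
    then obtain \<iota> where \<iota>: "\<phi> \<iota> = \<i>" by (metis surjD)
    have "\<exists>a b. c = of_real a + \<iota> * of_real b \<and> \<bar>a\<bar> \<le> norm c \<and> \<bar>b\<bar> \<le> norm c" for c :: 'k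
    proof (rule exI[of _ "Re (\<phi> c)"], rule exI[of _ "Im (\<phi> c)"], intro conjI)
      show "c = of_real (Re (\<phi> c)) + \<iota> * of_real (Im (\<phi> c))"
        by (rule inj) (simp add: add mult of_real \<iota> complex_eq[symmetric])
    qed (metis abs_Re_le_cmod abs_Im_le_cmod norm)+
    moreover have "norm \<iota> = 1" using norm[of \<iota>] \<iota> by simp
    ultimately show ?thesis by blast
  qed
qed

section \<open>Coordinates and greedy sets\<close>

context banach_basis
begin

lemma es_add: "es j (x + y) = es j x + es j y"
  and es_diff: "es j (x - y) = es j x - es j y"
  and es_scale: "es j (sc c x) = c * es j x"
  and es_zero: "es j 0 = 0"
  and es_sum: "es j (sum f A) = (\<Sum>i\<in>A. es j (f i))"
proof -
  interpret L: Vector_Spaces.linear sc "(*)" "es j" by (rule linear_es)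
  show "es j (x + y) = es j x + es j y" "es j (x - y) = es j x - es j y"
    "es j (sc c x) = c * es j x" "es j 0 = 0" "es j (sum f A) = (\<Sum>i\<in>A. es j (f i))"
    by (simp_all add: L.add L.diff L.scale L.sum)
qed

lemma es_combination:
  assumes "finite A"
  shows "es j (\<Sum>i\<in>A. sc (c i) (e i)) = (if j \<in> A then c j else 0)"
  using assms by (simp add: es_sum es_scale biorthogonal if_distrib cong: if_cong)

lemma es_signed_sum:
  "finite A \<Longrightarrow> es j (signed_sum sc e \<epsilon> A) = (if j \<in> A then \<epsilon> j else 0)"
  unfolding signed_sum_def by (rule es_combination)

lemma es_coord_proj:
  "finite A \<Longrightarrow> es j (coord_proj sc e es A x) = (if j \<in> A then es j x else 0)"
  unfolding coord_proj_def by (rule es_combination)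

lemma coord_proj_signed_sum:
  assumes "finite A" "B \<subseteq> A"
  shows "coord_proj sc e es B (signed_sum sc e \<epsilon> A) = signed_sum sc e \<epsilon> B"
  unfolding coord_proj_def signed_sum_def[of _ _ _ B]
  using assms by (intro sum.cong) (auto simp: es_signed_sum)

lemma signed_sum_Un:
  assumes "finite A" "finite B" "A \<inter> B = {}"
  shows "signed_sum sc e \<epsilon> (A \<union> B) = signed_sum sc e \<epsilon> A + signed_sum sc e \<epsilon> B"
  unfolding signed_sum_def using assms by (rule sum.union_disjoint)

lemma signed_sum_cong:
  "(\<And>j. j \<in> A \<Longrightarrow> \<epsilon> j = \<delta> j) \<Longrightarrow> signed_sum sc e \<epsilon> A = signed_sum sc e \<delta> A"
  unfolding signed_sum_def by (rule sum.cong) auto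

lemma signed_sum_one: "signed_sum sc e (\<lambda>_. 1) A = plain_sum e A"
  by (simp add: signed_sum_def plain_sum_def)

lemma norm_es_le_coeff_sup_norm: "norm (es j x) \<le> coeff_sup_norm es x"
  unfolding coeff_sup_norm_def
proof (rule cSUP_upper)
  obtain M where M: "onorm (es j) \<le> M" for j
    using norms_bdd by (meson UnI2 bdd_above_def rangeI)
  have "norm (es j x) \<le> M * norm x" for j
    using onorm[OF bounded_es, of j x] mult_right_mono[OF M, of "norm x"]
    by (meson norm_ge_zero order_trans)
  then show "bdd_above (range (\<lambda>j. norm (es j x)))"
    by (auto simp: bdd_above_def)
qed simp

lemma greedy_subset_signed_sum:
  assumes "finite A" "B \<subseteq> A" "is_sign \<delta>"
  shows "greedy_set es (signed_sum sc e \<delta> A) (card B) B"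
  using assms finite_subset[OF assms(2,1)]
  by (auto simp: greedy_set_def es_signed_sum is_sign_def)

section \<open>Estimates for quasi-greedy bases\<close>

text \<open>
  Sets of every order are admitted, the empty set included, so that the estimates below need no
  case distinction when a superlevel set happens to be empty.
\<close>

definition quasi_greedy_const :: "real \<Rightarrow> bool" where
  "quasi_greedy_const C \<longleftrightarrow> 0 < C \<and>
     (\<forall>x A. finite A \<longrightarrow> greedy_set es x (card A) A \<longrightarrow> norm (coord_proj sc e es A x) \<le> C * norm x)"

lemma quasi_greedy_iff: "quasi_greedy sc e es \<longleftrightarrow> (\<exists>C. quasi_greedy_const C)"
proof
  assume "quasi_greedy sc e es"
  then obtain C where C: "0 < C"
    "\<And>x m A. 1 \<le> m \<Longrightarrow> greedy_set es x m A \<Longrightarrow> norm (coord_proj sc e es A x) \<le> C * norm x"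
    unfolding quasi_greedy_def by blast
  have "norm (coord_proj sc e es A x) \<le> C * norm x"
    if "finite A" "greedy_set es x (card A) A" for x A
  proof (cases "A = {}")
    case True
    then show ?thesis using C(1) by (simp add: coord_proj_def)
  next
    case False
    then show ?thesis using that by (intro C(2)) (auto simp: Suc_le_eq card_gt_0_iff)
  qed
  then show "\<exists>C. quasi_greedy_const C" using C(1) unfolding quasi_greedy_const_def by blast
next
  assume "\<exists>C. quasi_greedy_const C"
  then show "quasi_greedy sc e es"
    unfolding quasi_greedy_const_def quasi_greedy_def greedy_set_def by metis
qed

lemma quasi_greedy_constD:
  assumes "quasi_greedy_const C" "greedy_set es x m A"
  shows "norm (coord_proj sc e es A x) \<le> C * norm x"
  using assms unfolding quasi_greedy_const_def greedy_set_def by blast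

text \<open>
  Every subset of \<open>A\<close> is a greedy set of \<open>1\<^bsub>\<delta>A\<^esub>\<close>, so all subsums are bounded. The factor 4
  comes from splitting the multipliers into the positive and negative parts of their real and
  imaginary parts.
\<close>

lemma norm_multiplier_sum_le:
  assumes C: "quasi_greedy_const C" and "finite A" and \<delta>: "is_sign \<delta>"
    and c: "\<And>j. j \<in> A \<Longrightarrow> norm (c j) \<le> 1"
  shows "norm (\<Sum>j\<in>A. sc (c j * \<delta> j) (e j)) \<le> 4 * C * norm (signed_sum sc e \<delta> A)"
proof -
  obtain \<iota> :: 'k where \<iota>: "norm \<iota> = 1"
    and dec: "\<And>c. \<exists>a b. c = of_real a + \<iota> * of_real b \<and> \<bar>a\<bar> \<le> norm c \<and> \<bar>b\<bar> \<le> norm c"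
    using ex_cartesian_decomposition by blast
  obtain a b where ab: "\<And>j. c j = of_real (a j) + \<iota> * of_real (b j)"
    "\<And>j. \<bar>a j\<bar> \<le> norm (c j)" "\<And>j. \<bar>b j\<bar> \<le> norm (c j)"
    using dec[of "c _"] by metis
  let ?v = "\<lambda>j. sc (\<delta> j) (e j)" and ?K = "C * norm (signed_sum sc e \<delta> A)"
  have subsums: "norm (\<Sum>j\<in>B. ?v j) \<le> ?K" if "B \<subseteq> A" for B
    using quasi_greedy_constD[OF C greedy_subset_signed_sum[OF \<open>finite A\<close> that \<delta>]]
    by (simp add: coord_proj_signed_sum[OF \<open>finite A\<close> that]) (simp add: signed_sum_def)
  have ra: "norm (\<Sum>j\<in>A. a j *\<^sub>R ?v j) \<le> 2 * ?K"
    by (rule norm_signed_weighted_sum_le[OF \<open>finite A\<close> subsums])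
      (auto intro: order_trans[OF ab(2) c])
  have rb: "norm (\<Sum>j\<in>A. b j *\<^sub>R ?v j) \<le> 2 * ?K"
    by (rule norm_signed_weighted_sum_le[OF \<open>finite A\<close> subsums])
      (auto intro: order_trans[OF ab(3) c])
  have "(\<Sum>j\<in>A. sc (c j * \<delta> j) (e j))
      = (\<Sum>j\<in>A. a j *\<^sub>R ?v j) + sc \<iota> (\<Sum>j\<in>A. b j *\<^sub>R ?v j)"
    by (simp add: ab(1) scale_of_real[symmetric] scale_sum_right sum.distrib[symmetric]
        scale_left_distrib distrib_right mult.assoc)
  also have "norm \<dots> \<le> 2 * ?K + 2 * ?K"
    by (rule norm_triangle_le, rule add_mono) (use ra rb \<iota> in \<open>auto simp: norm_scale\<close>)
  finally show ?thesis by simp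
qed

text \<open>
  The left-hand vector is \<open>P\<^sub>B z\<close> with weights \<open>t / \<bar>z\<^sub>j\<bar>\<close>. Where these weights are small the
  coefficients are large, so the complement in \<open>B\<close> of a superlevel set of the weights is again a
  greedy set of \<open>z\<close>.
\<close>

lemma norm_flattened_greedy_sum_le:
  assumes C: "quasi_greedy_const C" and B: "greedy_set es z m B"
    and "0 < t" and t: "\<And>j. j \<in> B \<Longrightarrow> t \<le> norm (es j z)"
  shows "t * norm (\<Sum>j\<in>B. sc (es j z / of_real (norm (es j z))) (e j)) \<le> 2 * C * norm z"
proof -
  have fin: "finite B" using B by (simp add: greedy_set_def)
  let ?w = "\<lambda>j. t / norm (es j z)" and ?v = "\<lambda>j. sc (es j z) (e j)"
  have superlevel: "norm (\<Sum>j\<in>{j\<in>B. s < ?w j}. ?v j) \<le> 2 * C * norm z" for s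
  proof -
    let ?G = "{j\<in>B. ?w j \<le> s}"
    have "greedy_set es z (card ?G) ?G"
      unfolding greedy_set_def
    proof (intro conjI ballI allI impI)
      fix i k assume i: "i \<in> ?G" and k: "k \<notin> ?G"
      show "norm (es k z) \<le> norm (es i z)"
      proof (cases "k \<in> B")
        case True
        then have less: "?w i < ?w k" using i k by auto
        have "0 < norm (es i z)" "0 < norm (es k z)"
          using t[of i] t[of k] i True \<open>0 < t\<close> by auto
        then show ?thesis using less \<open>0 < t\<close> by (simp add: field_simps)
      next
        case False
        then show ?thesis using B i unfolding greedy_set_def by blast
      qed
    qed (use fin in auto)
    then have G: "norm (\<Sum>j\<in>?G. ?v j) \<le> C * norm z"
      using quasi_greedy_constD[OF C] by (simp add: coord_proj_def)
    have "{j\<in>B. s < ?w j} = B - ?G" by auto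
    then have "(\<Sum>j\<in>{j\<in>B. s < ?w j}. ?v j) = (\<Sum>j\<in>B. ?v j) - (\<Sum>j\<in>?G. ?v j)"
      using fin by (simp add: sum_diff)
    moreover have "norm (\<Sum>j\<in>B. ?v j) \<le> C * norm z"
      using quasi_greedy_constD[OF C B] by (simp add: coord_proj_def)
    ultimately show ?thesis
      using G norm_triangle_ineq4[of "\<Sum>j\<in>B. ?v j" "\<Sum>j\<in>?G. ?v j"] by simp
  qed
  have "norm (\<Sum>j\<in>B. ?w j *\<^sub>R ?v j) \<le> 2 * C * norm z"
  proof (rule norm_weighted_sum_le[OF fin superlevel])
    fix j assume "j \<in> B"
    then show "0 \<le> ?w j \<and> ?w j \<le> 1" using t[of j] \<open>0 < t\<close> by (auto simp: divide_le_eq_1)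
  qed
  moreover have "(\<Sum>j\<in>B. ?w j *\<^sub>R ?v j)
      = t *\<^sub>R (\<Sum>j\<in>B. sc (es j z / of_real (norm (es j z))) (e j))"
    by (simp add: scale_of_real[symmetric] scale_sum_right)
  ultimately show ?thesis using \<open>0 < t\<close> by simp
qed

section \<open>The implications\<close>

lemma superconservative_imp_conservative:
  assumes "superconservative sc e n"
  shows "conservative e n"
proof -
  have "is_sign (\<lambda>_. 1 :: 'k)" by (simp add: is_sign_def)
  then show ?thesis
    using assms unfolding superconservative_def conservative_def signed_sum_one[symmetric]
    by fast
qed

lemma conservative_imp_superconservative:
  assumes "quasi_greedy sc e es" and "conservative e n"
  shows "superconservative sc e n"
proof -
  obtain C where C: "quasi_greedy_const C" using assms(1) quasi_greedy_iff by blast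
  obtain K where K: "0 < K"
    "\<And>A B. (A, B) \<in> admissible_pairs n \<Longrightarrow> norm (plain_sum e A) \<le> K * norm (plain_sum e B)"
    using assms(2) unfolding conservative_def by blast
  have pos: "0 < C" using C by (simp add: quasi_greedy_const_def)
  have "norm (signed_sum sc e \<epsilon> A) \<le> (4 * C) * (K * (4 * C)) * norm (signed_sum sc e \<delta> B)"
    if AB: "(A, B) \<in> admissible_pairs n" and \<epsilon>: "is_sign \<epsilon>" and \<delta>: "is_sign \<delta>" for A B \<epsilon> \<delta>
  proof -
    have fin: "finite A" "finite B" using AB by (auto simp: admissible_pairs_def)
    have "norm (signed_sum sc e \<epsilon> A) \<le> 4 * C * norm (plain_sum e A)"
      using norm_multiplier_sum_le[OF C fin(1), of "\<lambda>_. 1" \<epsilon>] \<epsilon>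
      by (simp add: is_sign_def signed_sum_one) (simp add: signed_sum_def)
    also have "\<dots> \<le> 4 * C * (K * norm (plain_sum e B))"
      using K(2)[OF AB] pos by (intro mult_left_mono) auto
    also have "norm (plain_sum e B) \<le> 4 * C * norm (signed_sum sc e \<delta> B)"
    proof -
      have "inverse (\<delta> j) * \<delta> j = 1" for j
        using \<delta> by (metis is_sign_def left_inverse norm_zero zero_neq_one)
      then show ?thesis
        using norm_multiplier_sum_le[OF C fin(2) \<delta>, of "\<lambda>j. inverse (\<delta> j)"] \<delta>
        by (simp add: is_sign_def norm_inverse plain_sum_def)
    qed
    finally show ?thesis using pos K(1) by (simp add: mult.assoc)
  qed
  moreover have "0 < (4 * C) * (K * (4 * C))" using pos K(1) by simp
  ultimately show ?thesis unfolding superconservative_def by blast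
qed

text \<open>
  Since \<open>B\<close> is a greedy set of \<open>y = x + 1\<^bsub>\<delta>B\<^esub>\<close>, both \<open>1\<^bsub>\<delta>B\<^esub>\<close> and \<open>x\<close> are dominated by \<open>y\<close>, and
  \<open>1\<^bsub>\<epsilon>A\<^esub>\<close> is dominated by \<open>1\<^bsub>\<delta>B\<^esub>\<close>.
\<close>

lemma superconservative_imp_pslc:
  assumes "quasi_greedy sc e es" and "superconservative sc e n"
  shows "pslc sc e es n"
proof -
  obtain C where C: "quasi_greedy_const C" using assms(1) quasi_greedy_iff by blast
  obtain K where K: "0 < K"
    "\<And>A B \<epsilon> \<delta>. (A, B) \<in> admissible_pairs n \<Longrightarrow> is_sign \<epsilon> \<Longrightarrow> is_sign \<delta> \<Longrightarrow>
       norm (signed_sum sc e \<epsilon> A) \<le> K * norm (signed_sum sc e \<delta> B)"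
    using assms(2) unfolding superconservative_def by blast
  have pos: "0 < C" using C by (simp add: quasi_greedy_const_def)
  have "norm (x + signed_sum sc e \<epsilon> A) \<le> (1 + C + K * C) * norm (x + signed_sum sc e \<delta> B)"
    if x: "coeff_sup_norm es x \<le> 1" and AB: "(A, B) \<in> admissible_pairs n"
      and disj: "B \<inter> coeff_supp es x = {}" and \<epsilon>: "is_sign \<epsilon>" and \<delta>: "is_sign \<delta>" for x A B \<epsilon> \<delta>
  proof -
    let ?y = "x + signed_sum sc e \<delta> B"
    have fin: "finite B" using AB by (auto simp: admissible_pairs_def)
    have es_y: "es j ?y = (if j \<in> B then \<delta> j else es j x)" for j
      using disj fin by (auto simp: es_add es_signed_sum coeff_supp_def)
    have "greedy_set es ?y (card B) B"
      using fin \<delta> order_trans[OF norm_es_le_coeff_sup_norm x]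
      by (auto simp: greedy_set_def es_y is_sign_def)
    moreover have "coord_proj sc e es B ?y = (\<Sum>j\<in>B. sc (\<delta> j) (e j))"
      unfolding coord_proj_def by (rule sum.cong) (simp_all add: es_y)
    then have "coord_proj sc e es B ?y = signed_sum sc e \<delta> B"
      by (simp only: signed_sum_def)
    ultimately have yB: "norm (signed_sum sc e \<delta> B) \<le> C * norm ?y"
      using quasi_greedy_constD[OF C] by metis
    have "norm x \<le> norm ?y + norm (signed_sum sc e \<delta> B)"
      using norm_triangle_ineq4[of ?y "signed_sum sc e \<delta> B"] by simp
    moreover have "norm (signed_sum sc e \<epsilon> A) \<le> K * (C * norm ?y)"
      using K(2)[OF AB \<epsilon> \<delta>] mult_left_mono[OF yB, of K] K(1) by linarith
    ultimately have "norm (x + signed_sum sc e \<epsilon> A) \<le> norm ?y + C * norm ?y + K * (C * norm ?y)"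
      using norm_triangle_ineq[of x "signed_sum sc e \<epsilon> A"] yB by linarith
    then show ?thesis by (simp add: algebra_simps)
  qed
  moreover have "1 \<le> 1 + C + K * C" using pos K(1) by simp
  ultimately show ?thesis unfolding pslc_def by blast
qed

lemma pslc_imp_superconservative:
  assumes "pslc sc e es n"
  shows "superconservative sc e n"
proof -
  obtain C where C: "1 \<le> C" and bound: "\<And>x A B \<epsilon> \<delta>. coeff_sup_norm es x \<le> 1 \<Longrightarrow>
      (A, B) \<in> admissible_pairs n \<Longrightarrow> B \<inter> coeff_supp es x = {} \<Longrightarrow>
      set_before A ((B \<union> coeff_supp es x) \<inter> range n) \<Longrightarrow> is_sign \<epsilon> \<Longrightarrow> is_sign \<delta> \<Longrightarrow>
      norm (x + signed_sum sc e \<epsilon> A) \<le> C * norm (x + signed_sum sc e \<delta> B)"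
    using assms unfolding pslc_def Ball_def split_paired_All case_prod_conv
    by metis
  have "coeff_sup_norm es 0 \<le> 1" "coeff_supp es 0 = {}"
    by (simp_all add: coeff_sup_norm_def coeff_supp_def es_zero)
  then have "norm (signed_sum sc e \<epsilon> A) \<le> C * norm (signed_sum sc e \<delta> B)"
    if "(A, B) \<in> admissible_pairs n" "is_sign \<epsilon>" "is_sign \<delta>" for A B \<epsilon> \<delta>
    using bound[of 0 A B \<epsilon> \<delta>] that by (simp add: admissible_pairs_def)
  then show ?thesis using C unfolding superconservative_def by (intro exI[of _ C]) auto
qed

lemma seq_partial_sum_eq_coord_proj:
  assumes "strict_mono n"
  shows "seq_partial_sum sc e es n k x = coord_proj sc e es (n ` {..<k}) x"
  unfolding seq_partial_sum_def coord_proj_def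
  by (subst sum.reindex)
    (use assms strict_mono_imp_inj_on in \<open>auto intro: inj_on_subset\<close>)

lemma strong_partially_greedyE:
  assumes "strong_partially_greedy sc e es n" and "strict_mono n"
  obtains C where "1 \<le> C" "\<And>x m A k. 1 \<le> m \<Longrightarrow> greedy_set es x m A \<Longrightarrow> k \<le> m \<Longrightarrow>
    norm (x - coord_proj sc e es A x) \<le> C * norm (x - coord_proj sc e es (n ` {..<k}) x)"
proof -
  obtain C where C: "1 \<le> C" "\<And>x m A. 1 \<le> m \<Longrightarrow> greedy_set es x m A \<Longrightarrow>
      norm (x - coord_proj sc e es A x) \<le> C * seq_error sc e es n m x"
    using assms(1) unfolding strong_partially_greedy_def by blast
  have "seq_error sc e es n m x \<le> norm (x - coord_proj sc e es (n ` {..<k}) x)"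
    if "k \<le> m" for x m k
    using that unfolding seq_error_def
    by (intro Min_le) (auto simp: seq_partial_sum_eq_coord_proj[OF assms(2)])
  then have "norm (x - coord_proj sc e es A x) \<le> C * norm (x - coord_proj sc e es (n ` {..<k}) x)"
    if "1 \<le> m" "greedy_set es x m A" "k \<le> m" for x m A k
    using C(2)[OF that(1,2)] that(3) C(1)
    by (meson mult_left_mono order_trans zero_le_one)
  then show thesis using that C(1) by blast
qed

lemma strong_partially_greedy_imp_quasi_greedy:
  assumes "strong_partially_greedy sc e es n" and "strict_mono n"
  shows "quasi_greedy sc e es"
proof -
  obtain C where C: "1 \<le> C" "\<And>x m A k. 1 \<le> m \<Longrightarrow> greedy_set es x m A \<Longrightarrow> k \<le> m \<Longrightarrow>
      norm (x - coord_proj sc e es A x) \<le> C * norm (x - coord_proj sc e es (n ` {..<k}) x)"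
    using assms by (rule strong_partially_greedyE) blast
  have "norm (coord_proj sc e es A x) \<le> (1 + C) * norm x"
    if "1 \<le> m" "greedy_set es x m A" for x m A
  proof -
    have "norm (x - coord_proj sc e es A x) \<le> C * norm x"
      using C(2)[OF that, of 0] by (simp add: coord_proj_def)
    then show ?thesis
      using norm_triangle_ineq4[of x "x - coord_proj sc e es A x"] by (simp add: algebra_simps)
  qed
  then show ?thesis using C(1) unfolding quasi_greedy_def by (intro exI[of _ "1 + C"]) auto
qed

lemma strong_partially_greedy_imp_superconservative:
  assumes "strong_partially_greedy sc e es n" and n: "strict_mono n"
  shows "superconservative sc e n"
proof -
  obtain C where C: "1 \<le> C" "\<And>x m A k. 1 \<le> m \<Longrightarrow> greedy_set es x m A \<Longrightarrow> k \<le> m \<Longrightarrow>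
      norm (x - coord_proj sc e es A x) \<le> C * norm (x - coord_proj sc e es (n ` {..<k}) x)"
    using assms by (rule strong_partially_greedyE) blast
  have "norm (signed_sum sc e \<epsilon> A) \<le> C * norm (signed_sum sc e \<delta> B)"
    if AB: "(A, B) \<in> admissible_pairs n" and \<epsilon>: "is_sign \<epsilon>" and \<delta>: "is_sign \<delta>" for A B \<epsilon> \<delta>
  proof (cases "A = {}")
    case True
    then show ?thesis using C(1) by (simp add: signed_sum_def)
  next
    case False
    have fin: "finite A" "finite B" and A: "A \<subseteq> range n" and card: "card A \<le> card B"
      and before: "set_before A (B \<inter> range n)"
      using AB by (auto simp: admissible_pairs_def)
    have "Max A \<in> A" using False fin by simp
    then obtain i where i: "Max A = n i" using A by auto
    define I where "I = n ` {..<Suc i}"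
    define D where "D = I - A"
    define \<eta> where "\<eta> j = (if j \<in> A then \<epsilon> j else if j \<in> B then \<delta> j else 1)" for j
    have \<eta>: "is_sign \<eta>" using \<epsilon> \<delta> by (simp add: is_sign_def \<eta>_def)
    have finI: "finite I" "finite D" by (simp_all add: I_def D_def)
    have cardI: "card I = Suc i"
      unfolding I_def using n strict_mono_imp_inj_on by (subst card_image) (auto intro: inj_on_subset)
    have "A \<subseteq> I"
    proof
      fix a assume a: "a \<in> A"
      then obtain j where j: "a = n j" using A by auto
      have "n j \<le> n i" using Max_ge[OF fin(1) a] i j by simp
      then show "a \<in> I" using n j by (auto simp: I_def strict_mono_less_eq less_Suc_eq_le)
    qed
    then have AD: "A \<union> D = I" "A \<inter> D = {}" by (auto simp: D_def)
    have IB: "I \<inter> B = {}"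
    proof (rule ccontr)
      assume "I \<inter> B \<noteq> {}"
      then obtain j where j: "j \<le> i" "n j \<in> B" by (auto simp: I_def less_Suc_eq_le)
      then have "n i < n j" using before \<open>Max A \<in> A\<close> i by (auto simp: set_before_def)
      then show False using n j(1) by (simp add: strict_mono_less)
    qed
    have disj: "A \<inter> (B \<union> D) = {}" "D \<inter> B = {}" using AD IB by auto
    \<comment> \<open>Padding \<open>A\<close> by \<open>D\<close> to an initial segment makes removal of \<open>A \<union> D\<close> a partial sum; its length
      does not exceed the order \<open>\<bar>B \<union> D\<bar>\<close> because \<open>\<bar>A\<bar> \<le> \<bar>B\<bar>\<close>.\<close>
    let ?x = "signed_sum sc e \<eta> (A \<union> (B \<union> D))"
    have x_A: "?x - coord_proj sc e es (B \<union> D) ?x = signed_sum sc e \<eta> A"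
      using fin finI disj by (subst coord_proj_signed_sum) (auto simp: signed_sum_Un)
    have "A \<union> (B \<union> D) = I \<union> B" using AD by auto
    then have x_B: "?x - coord_proj sc e es I ?x = signed_sum sc e \<eta> B"
      using fin finI IB by (subst coord_proj_signed_sum) (auto simp: signed_sum_Un)
    have "card I = card A + card D"
      using card_Un_disjoint[of A D] fin finI AD by simp
    moreover have "card (B \<union> D) = card B + card D"
      using fin finI disj by (subst card_Un_disjoint) auto
    ultimately have le: "Suc i \<le> card (B \<union> D)" using card cardI by simp
    have "greedy_set es ?x (card (B \<union> D)) (B \<union> D)"
      using fin finI \<eta> by (intro greedy_subset_signed_sum) auto
    then have "norm (signed_sum sc e \<eta> A) \<le> C * norm (signed_sum sc e \<eta> B)"
      using C(2)[of "card (B \<union> D)" ?x "B \<union> D" "Suc i"] le x_A x_B by (simp add: I_def[symmetric])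
    moreover have "signed_sum sc e \<eta> A = signed_sum sc e \<epsilon> A"
      by (rule signed_sum_cong) (simp add: \<eta>_def)
    moreover have "signed_sum sc e \<eta> B = signed_sum sc e \<delta> B"
      using disj by (intro signed_sum_cong) (auto simp: \<eta>_def)
    ultimately show ?thesis by simp
  qed
  then show ?thesis using C(1) unfolding superconservative_def by (intro exI[of _ C]) auto
qed

lemma superconservative_imp_strong_partially_greedy:
  assumes "quasi_greedy sc e es" and "superconservative sc e n" and n: "strict_mono n"
  shows "strong_partially_greedy sc e es n"
proof -
  obtain C where C: "quasi_greedy_const C" using assms(1) quasi_greedy_iff by blast
  obtain K where K: "0 < K"
    "\<And>A B \<epsilon> \<delta>. (A, B) \<in> admissible_pairs n \<Longrightarrow> is_sign \<epsilon> \<Longrightarrow> is_sign \<delta> \<Longrightarrow>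
       norm (signed_sum sc e \<epsilon> A) \<le> K * norm (signed_sum sc e \<delta> B)"
    using assms(2) unfolding superconservative_def by blast
  have pos: "0 < C" using C by (simp add: quasi_greedy_const_def)
  let ?M = "1 + C + 4 * C * (K * (2 * C))"
  have main: "norm (x - coord_proj sc e es A x)
      \<le> ?M * norm (x - coord_proj sc e es (n ` {..<k}) x)"
    if A: "greedy_set es x m A" and "k \<le> m" for x m A k
  proof -
    define D where "D = n ` {..<k}"
    define z where "z = x - coord_proj sc e es D x"
    define S where "S = D - A"
    define B where "B = A - D"
    have fin: "finite A" "finite D" "finite S" "finite B"
      using A by (auto simp: greedy_set_def D_def S_def B_def)
    have "card D = k"
      unfolding D_def using n strict_mono_imp_inj_on by (subst card_image) (auto intro: inj_on_subset)
    then have card_DA: "card D \<le> card A" using A \<open>k \<le> m\<close> by (simp add: greedy_set_def)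
    have "card S \<le> card B"
      using card_DA fin card_Int_Diff[of D A] card_Int_Diff[of A D]
      by (simp add: S_def B_def Int_commute)
    moreover have "set_before S (B \<inter> range n)"
      unfolding set_before_def
    proof (intro ballI)
      fix a b assume "a \<in> S" and "b \<in> B \<inter> range n"
      then obtain i j where "a = n i" "i < k" "b = n j" "\<not> j < k"
        by (auto simp: S_def B_def D_def)
      then show "a < b" using n by (simp add: strict_mono_less)
    qed
    ultimately have SB: "(S, B) \<in> admissible_pairs n"
      using fin by (auto simp: admissible_pairs_def S_def D_def)
    have es_z: "es j z = (if j \<in> D then 0 else es j x)" for j
      using fin by (simp add: z_def es_diff es_coord_proj)
    have B: "greedy_set es z (card B) B"
      using A fin by (auto simp: greedy_set_def es_z B_def)
    have PB: "norm (coord_proj sc e es B x) \<le> C * norm z"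
    proof -
      have "coord_proj sc e es B x = coord_proj sc e es B z"
        unfolding coord_proj_def by (rule sum.cong) (auto simp: es_z B_def)
      then show ?thesis using quasi_greedy_constD[OF C B] by simp
    qed
    have PS: "norm (coord_proj sc e es S x) \<le> 4 * C * (K * (2 * C)) * norm z"
    proof (cases "\<forall>j\<in>S. es j x = 0")
      case True
      then have "coord_proj sc e es S x = 0" by (simp add: coord_proj_def)
      then show ?thesis using pos K(1) by simp
    next
      case False
      define t where "t = Max ((\<lambda>j. norm (es j x)) ` S)"
      have t_ge: "norm (es j x) \<le> t" if "j \<in> S" for j
        using that fin by (simp add: t_def)
      have "0 < t" using False t_ge by (metis norm_le_zero_iff not_le order_trans)
      have "t \<in> (\<lambda>j. norm (es j x)) ` S"
        unfolding t_def using fin False by (intro Max_in) auto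
      then obtain j0 where j0: "j0 \<in> S" "t = norm (es j0 x)" by auto
      have t_le: "t \<le> norm (es j z)" if "j \<in> B" for j
        using A that j0 by (auto simp: greedy_set_def es_z S_def B_def)
      \<comment> \<open>Off \<open>B\<close> the coefficients of \<open>z\<close> may vanish, so the sign is completed by 1 there.\<close>
      define \<delta> where "\<delta> j = (if j \<in> B then es j z / of_real (norm (es j z)) else 1)" for j
      have \<delta>: "is_sign \<delta>"
        using t_le \<open>0 < t\<close> by (force simp: is_sign_def \<delta>_def norm_divide)
      have one: "is_sign (\<lambda>_. 1 :: 'k)" by (simp add: is_sign_def)
      have flat: "t * norm (signed_sum sc e \<delta> B) \<le> 2 * C * norm z"
        using norm_flattened_greedy_sum_le[OF C B \<open>0 < t\<close> t_le]
        by (simp add: signed_sum_def \<delta>_def)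
      have "coord_proj sc e es S x = t *\<^sub>R (\<Sum>j\<in>S. sc (es j x / of_real t * 1) (e j))"
        using \<open>0 < t\<close> by (simp add: coord_proj_def scale_of_real[symmetric] scale_sum_right)
      then have "norm (coord_proj sc e es S x)
          = t * norm (\<Sum>j\<in>S. sc (es j x / of_real t * 1) (e j))"
        using \<open>0 < t\<close> by simp
      also have "\<dots> \<le> t * (4 * C * norm (signed_sum sc e (\<lambda>_. 1) S))"
        using \<open>0 < t\<close> t_ge
        by (intro mult_left_mono norm_multiplier_sum_le[OF C fin(3) one])
          (auto simp: norm_divide)
      also have "\<dots> \<le> t * (4 * C * (K * norm (signed_sum sc e \<delta> B)))"
        using \<open>0 < t\<close> pos K(2)[OF SB one \<delta>] by (intro mult_left_mono) auto
      also have "\<dots> = 4 * C * K * (t * norm (signed_sum sc e \<delta> B))" by simp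
      also have "\<dots> \<le> 4 * C * K * (2 * C * norm z)"
        using flat pos K(1) by (intro mult_left_mono) auto
      finally show ?thesis by (simp add: mult.assoc)
    qed
    have "coord_proj sc e es A x = coord_proj sc e es (A \<inter> D) x + coord_proj sc e es B x"
      "coord_proj sc e es D x = coord_proj sc e es (A \<inter> D) x + coord_proj sc e es S x"
      using sum.Int_Diff[OF fin(1), of _ D] sum.Int_Diff[OF fin(2), of _ A]
      by (auto simp: coord_proj_def B_def S_def Int_commute)
    then have "x - coord_proj sc e es A x = z - coord_proj sc e es B x + coord_proj sc e es S x"
      by (simp add: z_def)
    also have "norm \<dots> \<le> norm z + norm (coord_proj sc e es B x) + norm (coord_proj sc e es S x)"
      by (meson add_right_mono norm_triangle_ineq norm_triangle_ineq4 order_trans)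
    also have "\<dots> \<le> ?M * norm z"
      using PB PS by (simp add: distrib_right)
    finally show ?thesis by (simp only: z_def D_def)
  qed
  have "norm (x - coord_proj sc e es A x) \<le> ?M * seq_error sc e es n m x"
    if "greedy_set es x m A" for x m A
  proof -
    have "seq_error sc e es n m x \<in> (\<lambda>k. norm (x - seq_partial_sum sc e es n k x)) ` {0..m}"
      unfolding seq_error_def by (rule Min_in) auto
    then obtain k where "k \<le> m"
      "seq_error sc e es n m x = norm (x - coord_proj sc e es (n ` {..<k}) x)"
      by (auto simp: seq_partial_sum_eq_coord_proj[OF n])
    then show ?thesis using main[OF that] by simp
  qed
  moreover have "1 \<le> ?M" using pos K(1) by simp
  ultimately show ?thesis unfolding strong_partially_greedy_def by blast
qed

end

theorem theorem2p6:
  fixes sc :: "'k::real_or_complex \<Rightarrow> 'a::banach \<Rightarrow> 'a"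
    and e :: "nat \<Rightarrow> 'a" and es :: "nat \<Rightarrow> 'a \<Rightarrow> 'k" and n :: "nat \<Rightarrow> nat"
  assumes "separable_space (euclidean :: 'a topology)"
    and "infinite_dimensional sc"
    and "banach_basis sc e es"
    and "strict_mono n"
  shows "(strong_partially_greedy sc e es n \<longleftrightarrow> quasi_greedy sc e es \<and> pslc sc e es n) \<and>
         (strong_partially_greedy sc e es n \<longleftrightarrow> quasi_greedy sc e es \<and> superconservative sc e n) \<and>
         (strong_partially_greedy sc e es n \<longleftrightarrow> quasi_greedy sc e es \<and> conservative e n)"
proof -
  interpret banach_basis sc e es by (rule assms(3))
  show ?thesis
    using strong_partially_greedy_imp_quasi_greedy[OF _ assms(4)]
      strong_partially_greedy_imp_superconservative[OF _ assms(4)]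
      superconservative_imp_strong_partially_greedy[OF _ _ assms(4)]
      superconservative_imp_pslc pslc_imp_superconservative
      superconservative_imp_conservative conservative_imp_superconservative
    by blast
qed

end
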